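(* Let $M^*\in\mathbb R^{d\times d}$ be symmetric positive semidefinite of rank $r$, with factorization $M^*=F^*(F^* )^\top$, $F^*\in\mathbb R^{d\times r}$, and let $\sigma_1(F^* )\ge\dots\ge\sigma_r(F^* )>0$ and $\kappa=\sigma_1(F^* )/\sigma_r(F^* )$. Let $\tilde{\mathcal L}_n:\mathbb R^{d\times r}\to\mathbb R$, $\tilde{\mathcal L}_n(F)=\mathcal L_n(FF^\top)$, and let $\mathcal F\subseteq\mathbb R^{d\times r}$ be a convex set. Let $0<\alpha\le L$, $\varepsilon_n\ge 0$, $\tau\in(0,\tfrac12)$, and suppose $\varepsilon_n\le\frac{1-\tau}{2}\sigma_r(F^* )$. Put $\rho=(1-\tau)\sigma_r(F^* )$. Suppose that - $\mathcal F$ is $M^*$-faithful with radius $\rho$; - $\tilde{\mathcal L}_n$ satisfies the local descent condition over $\mathcal F$ with parameters $(\alpha,\beta,\varepsilon_n,\rho)$ for some $\beta>0$; - $\tilde{\mathcal L}_n$ satisfies the local Lipschitz condition with parameters $(L,\rho)$. Then for any initial point $F^0\in\mathcal F\cap\mathbb B_2((1-\tau)\sigma_r(F^* );F^* )$, the projected gradient iterates $$F^{t+1}=\Pi_{\mathcal F}\big(F^t-\eta^t\nabla\tilde{\mathcal L}_n(F^t)\big),\qquad \eta^t=\frac{1}{\alpha\,(t+20\kappa^2L^2/\alpha^2)},\qquad t=0,1,2,\dots$$ satisfy $$d^2(F^t,F^* )\le \frac{20L^2\,\|F^*\|_{op}^2}{t\,\alpha^2}+4\varepsilon_n^2\qquad\text{for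 all } t=1,2,\dots.$$
   Context: Notation: $\|\cdot\|_F$ is the Frobenius norm, $\|\cdot\|_{op}$ the spectral norm, $\langle\langle A,B\rangle\rangle=\operatorname{trace}(A^\top B)$, and $\Pi_{\mathcal F}$ is the Euclidean (Frobenius) projection onto $\mathcal F$ (assumed well defined). $\mathcal L_n$ is a differentiable real-valued function on symmetric $d\times d$ matrices and $\nabla\tilde{\mathcal L}_n$ is the gradient of $\tilde{\mathcal L}_n$ with respect to $F$. Set of equivalent factorizations: $\mathcal E(M^* )=\{A\in\mathbb R^{d\times r}: AA^\top=M^*,\ A_{\cdot i}^\top A_{\cdot j}=0\ \forall i\ne j\}$, and $F^*$ denotes an element of it; all elements have the same singular values, so $\sigma_j(F^* )$ and $\|F^*\|_{op}$ are unambiguous. Distance: $d(F,F^* )=\min_{A\in\mathcal E(M^* )}\|F-A\|_F$. Ball: $\mathbb B_2(\rho;F^* )=\{F\in\mathbb R^{d\times r}: d(F,F^* )\le\rho\}$. $M^*$-faithfulness (radius $\rho$): for each $F\in\mathcal F\cap\mathbb B_2(\rho;F^* )$, $\arg\min_{A\in\mathcal E(M^* )}\|A-F\|_F\subseteq\mathcal F$. Local descent condition with parameters $(\alpha,\beta,\varepsilon_n,\rho)$ over $\mathcal F$: for each $F\in\mathcal F\cap\mathbb B_2(\rho;F^* )$ there is some $F_{\pi^*}\in\arg\min_{A\in\mathcal E(M^* )}\|A-F\|_F$ such that for all $A\in\mathcal E(M^* )$, $$\langle\langle\nabla\tilde{\mathcal L}_n(F),F-A\rangle\rangle\ge\alpha\|F-F_{\pi^*}\|_F^2-\frac{\beta^2}{\alpha}\|F_{\pi^*}-A\|_F^2-\alpha\varepsilon_n^2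 .$$ Local Lipschitz condition with parameters $(L,\rho)$: $\|\nabla\tilde{\mathcal L}_n(F)\|_F\le L\|F^*\|_{op}$ for all $F\in\mathcal F\cap\mathbb B_2(\rho;F^* )$. *)

theory Defs
  imports "HOL-Analysis.Analysis"
begin

text \<open>
  A real matrix with rows indexed by \<open>'d\<close> and columns by \<open>'r\<close> has type \<open>real^'r^'d\<close>.
  On this type \<open>norm\<close> and \<open>dist\<close> are the Frobenius norm and distance, and \<open>\<bullet>\<close> is the
  trace inner product.
\<close>

lemma inner_matrix_eq_trace:
  fixes A B :: "real^'r^'d"
  shows "A \<bullet> B = trace (transpose A ** B)"
proof -
  have "A \<bullet> B = (\<Sum>i\<in>UNIV. \<Sum>j\<in>UNIV. A $ i $ j * B $ i $ j)"
    by (simp add: inner_vec_def)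
  also have "\<dots> = (\<Sum>j\<in>UNIV. \<Sum>i\<in>UNIV. A $ i $ j * B $ i $ j)"
    by (rule sum.swap)
  finally show ?thesis
    by (simp add: trace_def matrix_matrix_mult_def transpose_def)
qed

lemma norm_matrix_eq_sqrt_trace:
  fixes A :: "real^'r^'d"
  shows "norm A = sqrt (trace (transpose A ** A))"
  by (simp add: norm_eq_sqrt_inner inner_matrix_eq_trace)

definition symmetric_matrices :: "(real^'d^'d) set" where
  "symmetric_matrices = {M. transpose M = M}"

definition positive_semidefinite :: "real^'d^'d \<Rightarrow> bool" where
  "positive_semidefinite M \<longleftrightarrow> (\<forall>x. 0 \<le> x \<bullet> (M *v x))"

definition spectral_norm :: "real^'n^'m \<Rightarrow> real" where
  "spectral_norm A = onorm ((*v) A)"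

text \<open>
  The singular values of \<open>A\<close> are the square roots of the eigenvalues of \<open>A\<^sup>T A\<close>. Each
  eigenvalue is repeated according to the dimension of its eigenspace, so the list has one
  entry per column of \<open>A\<close>, in non-increasing order. The set that is being sorted is finite, as
  \<open>A\<^sup>T A\<close> has only finitely many eigenvalues.
\<close>

definition gram_eigenspace :: "real^'n^'m \<Rightarrow> real \<Rightarrow> (real^'n) set" where
  "gram_eigenspace A l = {v. (transpose A ** A) *v v = l *\<^sub>R v}"

definition singular_values :: "real^'n^'m \<Rightarrow> real list" where
  "singular_values A =
     concat (map (\<lambda>s. replicate (dim (gram_eigenspace A (s\<^sup>2))) s)
       (rev (sorted_list_of_set {s. 0 \<le> s \<and> (\<exists>v\<in>gram_eigenspace A (s\<^sup>2). v \<noteq> 0)})))"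

text \<open>Singular values are numbered from 1 to \<open>CARD('n)\<close>, starting with the largest.\<close>

definition singular_value :: "real^'n^'m \<Rightarrow> nat \<Rightarrow> real" where
  "singular_value A j = singular_values A ! (j - 1)"

definition gradient :: "('a::real_inner \<Rightarrow> real) \<Rightarrow> 'a \<Rightarrow> 'a" where
  "gradient f x = (THE D. GDERIV f x :> D)"

definition equiv_factors :: "real^'d^'d \<Rightarrow> (real^'r^'d) set" where
  "equiv_factors M =
     {A. A ** transpose A = M \<and> (\<forall>i j. i \<noteq> j \<longrightarrow> column i A \<bullet> column j A = 0)}"

lemma compact_equiv_factors:
  fixes M :: "real^'d^'d"
  shows "compact (equiv_factors M :: (real^'r^'d) set)"
proof -
  have eq: "equiv_factors M =
      (\<Inter>i. \<Inter>j. {A :: real^'r^'d. (A ** transpose A) $ i $ j = M $ i $ j}) \<inter>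
      (\<Inter>i. \<Inter>j\<in>-{i}. {A. column i A \<bullet> column j A = 0})"
    by (auto simp: equiv_factors_def vec_eq_iff)
  have "closed {A :: real^'r^'d. (A ** transpose A) $ i $ j = M $ i $ j}" for i j
    by (simp add: matrix_matrix_mult_def transpose_def, intro closed_Collect_eq continuous_intros)
  moreover have "closed {A :: real^'r^'d. column i A \<bullet> column j A = 0}" for i j
    by (simp add: column_def inner_vec_def, intro closed_Collect_eq continuous_intros)
  ultimately have "closed (equiv_factors M :: (real^'r^'d) set)"
    unfolding eq by (intro closed_Int closed_INT ballI)
  moreover have "norm A \<le> sqrt (trace M)" if "A \<in> equiv_factors M" for A :: "real^'r^'d"
  proof -
    have "trace (transpose A ** A) = trace (A ** transpose A)"
      unfolding trace_def matrix_matrix_mult_def transpose_def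
      by (simp add: mult.commute) (rule sum.swap)
    then show ?thesis
      using that by (simp add: norm_matrix_eq_sqrt_trace equiv_factors_def)
  qed
  then have "bounded (equiv_factors M :: (real^'r^'d) set)"
    by (auto simp: bounded_iff)
  ultimately show ?thesis by (simp add: compact_eq_bounded_closed)
qed

text \<open>
  The distance and the ball depend on \<open>F\<^sup>*\<close> only through \<open>M = F\<^sup>* (F\<^sup>*)\<^sup>T\<close>. If \<open>M\<close> has a
  factorization at all, the infimum in \<open>infdist\<close> is attained.
\<close>

definition factor_dist :: "real^'d^'d \<Rightarrow> real^'r^'d \<Rightarrow> real" where
  "factor_dist M F = infdist F (equiv_factors M)"

lemma factor_dist_attained:
  fixes F :: "real^'r^'d"
  assumes "(equiv_factors M :: (real^'r^'d) set) \<noteq> {}"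
  shows "\<exists>A\<in>equiv_factors M. factor_dist M F = norm (F - A) \<and>
           (\<forall>B\<in>equiv_factors M. norm (F - A) \<le> norm (F - B))"
proof -
  obtain A where "A \<in> equiv_factors M" "infdist F (equiv_factors M) = dist F A"
    using infdist_attains_inf[OF compact_imp_closed[OF compact_equiv_factors] assms] by blast
  then show ?thesis
    by (metis dist_norm factor_dist_def infdist_le)
qed

definition factor_ball :: "real^'d^'d \<Rightarrow> real \<Rightarrow> (real^'r^'d) set" where
  "factor_ball M \<rho> = {F. factor_dist M F \<le> \<rho>}"

definition nearest_factors :: "real^'d^'d \<Rightarrow> real^'r^'d \<Rightarrow> (real^'r^'d) set" where
  "nearest_factors M F =
     {A. is_arg_min (\<lambda>A. norm (A - F)) (\<lambda>A. A \<in> equiv_factors M) A}"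

definition faithful :: "real^'d^'d \<Rightarrow> (real^'r^'d) set \<Rightarrow> real \<Rightarrow> bool" where
  "faithful M \<F> \<rho> \<longleftrightarrow> (\<forall>F\<in>\<F> \<inter> factor_ball M \<rho>. nearest_factors M F \<subseteq> \<F>)"

definition local_descent_cond ::
  "(real^'r^'d \<Rightarrow> real) \<Rightarrow> real^'d^'d \<Rightarrow> (real^'r^'d) set \<Rightarrow> real \<Rightarrow> real \<Rightarrow> real \<Rightarrow> real \<Rightarrow> bool"
where
  "local_descent_cond f M \<F> \<alpha> \<beta> \<epsilon> \<rho> \<longleftrightarrow>
     (\<forall>F\<in>\<F> \<inter> factor_ball M \<rho>. \<exists>F\<pi>\<in>nearest_factors M F. \<forall>A\<in>equiv_factors M.
        gradient f F \<bullet> (F - A)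
          \<ge> \<alpha> * (norm (F - F\<pi>))\<^sup>2 - \<beta>\<^sup>2 / \<alpha> * (norm (F\<pi> - A))\<^sup>2 - \<alpha> * \<epsilon>\<^sup>2)"

definition local_lipschitz_cond ::
  "(real^'r^'d \<Rightarrow> real) \<Rightarrow> real^'d^'d \<Rightarrow> real^'r^'d \<Rightarrow> (real^'r^'d) set \<Rightarrow> real \<Rightarrow> real \<Rightarrow> bool"
where
  "local_lipschitz_cond f M Fstar \<F> L \<rho> \<longleftrightarrow>
     (\<forall>F\<in>\<F> \<inter> factor_ball M \<rho>. norm (gradient f F) \<le> L * spectral_norm Fstar)"

end

theory Submission
  imports Defs
begin

text \<open>
  The columns of \<open>F\<^sup>*\<close> are orthogonal, so its singular values are the norms of its columns and
  no spectral theorem is needed. Testing the descent condition at \<open>A = F\<^sub>\<pi>\<close> makes the \<open>\<beta>\<close>-term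
  vanish. As the projection is nonexpansive and fixes \<open>F\<^sub>\<pi>\<close>, the squared distances \<open>a\<^sub>t\<close> satisfy
  \<open>a\<^sub>t\<^sub>+\<^sub>1 \<le> (1 - 2 / s) a\<^sub>t + 2 \<epsilon>\<^sup>2 / s + Q / s\<^sup>2\<close> with \<open>s = t + 20 \<kappa>\<^sup>2 L\<^sup>2 / \<alpha>\<^sup>2\<close> and
  \<open>Q = L\<^sup>2 \<parallel>F\<^sup>*\<parallel>\<^sub>o\<^sub>p\<^sup>2 / \<alpha>\<^sup>2\<close>. This recursion preserves both \<open>a\<^sub>t \<le> \<rho>\<^sup>2\<close> and \<open>a\<^sub>t \<le> 20 Q / s + \<epsilon>\<^sup>2\<close>.
\<close>

section \<open>Singular values of a matrix with orthogonal columns\<close>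

lemma gram_mult_nth_orthogonal:
  fixes A :: "real^'n^'m"
  assumes "\<forall>i j. i \<noteq> j \<longrightarrow> column i A \<bullet> column j A = 0"
  shows "((transpose A ** A) *v v) $ i = (norm (column i A))\<^sup>2 * v $ i"
proof -
  have "((transpose A ** A) *v v) $ i = (\<Sum>j\<in>UNIV. (column i A \<bullet> column j A) * v $ j)"
    by (simp add: matrix_mult_transpose_dot_column matrix_vector_mult_def)
  also have "\<dots> = (\<Sum>j\<in>UNIV. if j = i then (norm (column i A))\<^sup>2 * v $ j else 0)"
    by (intro sum.cong refl) (use assms in \<open>auto simp: power2_norm_eq_inner\<close>)
  finally show ?thesis by simp
qed

text \<open>Orthogonal columns make the Gram matrix diagonal, so its eigenspaces are coordinate
  subspaces. The bound \<open>0 \<le> s\<close> turns equal squares into equal norms; the form of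
  the right-hand side fits \<open>dim_substandard_cart\<close>.\<close>

lemma gram_eigenspace_orthogonal:
  fixes A :: "real^'n^'m"
  assumes "\<forall>i j. i \<noteq> j \<longrightarrow> column i A \<bullet> column j A = 0" and "0 \<le> s"
  shows "gram_eigenspace A (s\<^sup>2) = {v. \<forall>i. i \<notin> {i. norm (column i A) = s} \<longrightarrow> v $ i = 0}"
  using assms
  by (auto simp: gram_eigenspace_def vec_eq_iff gram_mult_nth_orthogonal)

lemma dim_gram_eigenspace_orthogonal:
  fixes A :: "real^'n^'m"
  assumes "\<forall>i j. i \<noteq> j \<longrightarrow> column i A \<bullet> column j A = 0" and "0 \<le> s"
  shows "dim (gram_eigenspace A (s\<^sup>2)) = card {i. norm (column i A) = s}"
  unfolding gram_eigenspace_orthogonal[OF assms] dim_vec_eq[symmetric] by (rule dim_substandard_cart)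

lemma sorted_wrt_concat_replicate:
  fixes xs :: "'a::preorder list"
  assumes "sorted_wrt (\<ge>) xs"
  shows "sorted_wrt (\<ge>) (concat (map (\<lambda>s. replicate (n s) s) xs))"
proof -
  have "sorted_wrt (\<ge>) (replicate k x)" for k and x :: 'a
    by (induction k) auto
  then show ?thesis
    using assms by (induction xs) (auto simp: sorted_wrt_append)
qed

text \<open>The eigenspace for s^2 has one dimension per column of norm s, so the list consists of
  the column norms with multiplicity, sorted. The length keeps the first and last index in
  range.\<close>

lemma
  fixes A :: "real^'n^'m"
  assumes orth: "\<forall>i j. i \<noteq> j \<longrightarrow> column i A \<bullet> column j A = 0"
  shows set_singular_values_orthogonal:
      "set (singular_values A) = range (\<lambda>i. norm (column i A))"
    and length_singular_values_orthogonal: "length (singular_values A) = CARD('n)"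
    and sorted_singular_values_orthogonal: "sorted_wrt (\<ge>) (singular_values A)"
proof -
  let ?V = "range (\<lambda>i. norm (column i A))"
  let ?xs = "rev (sorted_list_of_set ?V)"
  let ?n = "\<lambda>s. dim (gram_eigenspace A (s\<^sup>2))"
  have "(\<exists>v\<in>gram_eigenspace A (s\<^sup>2). v \<noteq> 0) \<longleftrightarrow> s \<in> ?V" if "0 \<le> s" for s
  proof
    assume "\<exists>v\<in>gram_eigenspace A (s\<^sup>2). v \<noteq> 0"
    then show "s \<in> ?V"
      unfolding gram_eigenspace_orthogonal[OF orth that] by (auto simp: vec_eq_iff)
  next
    assume "s \<in> ?V"
    then obtain i where "s = norm (column i A)" by blast
    then have "axis i 1 \<in> gram_eigenspace A (s\<^sup>2)"
      unfolding gram_eigenspace_orthogonal[OF orth that] by (auto simp: axis_def)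
    then show "\<exists>v\<in>gram_eigenspace A (s\<^sup>2). v \<noteq> 0"
      by (intro bexI[of _ "axis i 1"]) (auto simp: axis_eq_0_iff)
  qed
  then have "{s. 0 \<le> s \<and> (\<exists>v\<in>gram_eigenspace A (s\<^sup>2). v \<noteq> 0)} = ?V"
    by auto
  then have sv: "singular_values A = concat (map (\<lambda>s. replicate (?n s) s) ?xs)"
    by (simp add: singular_values_def)
  have n: "?n s = card {i. norm (column i A) = s}" if "s \<in> ?V" for s
    using that by (intro dim_gram_eigenspace_orthogonal[OF orth]) auto
  \<comment> \<open>A zero multiplicity would make \<open>replicate\<close> drop the value from the
    list.\<close>
  then have n_nonzero: "?n s \<noteq> 0" if "s \<in> ?V" for s
    using that by auto
  have "set (singular_values A) = (\<Union>s\<in>?V. set (replicate (?n s) s))"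
    unfolding sv set_concat set_map set_rev by simp
  also have "\<dots> = (\<Union>s\<in>?V. {s})"
    by (intro SUP_cong refl set_replicate n_nonzero)
  finally show "set (singular_values A) = ?V"
    by simp
  have "length (singular_values A) = (\<Sum>s\<leftarrow>?xs. ?n s)"
    by (simp add: sv length_concat comp_def)
  also have "\<dots> = (\<Sum>s\<in>?V. ?n s)"
    by (subst sum_list_distinct_conv_sum_set) auto
  also have "\<dots> = (\<Sum>s\<in>?V. card {i\<in>UNIV. norm (column i A) = s})"
    using n by (intro sum.cong) auto
  \<comment> \<open>The columns are counted by the fibres of the column norm.\<close>
  also have "\<dots> = CARD('n)"
    using sum.image_gen[of UNIV "\<lambda>_. 1::nat" "\<lambda>i. norm (column i A)"] by simp
  finally show "length (singular_values A) = CARD('n)" .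
  show "sorted_wrt (\<ge>) (singular_values A)"
    unfolding sv by (intro sorted_wrt_concat_replicate) (simp add: sorted_wrt_rev)
qed

text \<open>A column norm is at most the spectral norm, and positive once the column is nonzero;
  both bounds thereby pass to the last singular value.\<close>

lemma singular_value_last_orthogonal:
  fixes A :: "real^'n^'m"
  assumes "\<forall>i j. i \<noteq> j \<longrightarrow> column i A \<bullet> column j A = 0"
  obtains i where "singular_value A CARD('n) = norm (column i A)"
proof -
  have "singular_value A CARD('n) \<in> set (singular_values A)"
    unfolding singular_value_def
    by (intro nth_mem) (simp add: length_singular_values_orthogonal[OF assms])
  then show thesis
    using that set_singular_values_orthogonal[OF assms] by auto
qed

section \<open>Spectral norm and nonzero columns\<close>

lemma norm_mult_vec_orthogonal:
  fixes A :: "real^'n^'m"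
  assumes "\<forall>i j. i \<noteq> j \<longrightarrow> column i A \<bullet> column j A = 0"
  shows "(norm (A *v v))\<^sup>2 = (\<Sum>i\<in>UNIV. (norm (column i A))\<^sup>2 * (v $ i)\<^sup>2)"
proof -
  have "(norm (A *v v))\<^sup>2 = v \<bullet> ((transpose A ** A) *v v)"
    by (metis dot_lmul_matrix matrix_vector_mul_assoc power2_norm_eq_inner vector_transpose_matrix)
  then show ?thesis
    by (simp add: inner_vec_def gram_mult_nth_orthogonal[OF assms] power2_eq_square mult_ac)
qed

lemma norm_column_le_spectral_norm:
  fixes A :: "real^'n^'m"
  shows "norm (column i A) \<le> spectral_norm A"
  using onorm[OF matrix_vector_mul_bounded_linear, of A "axis i 1"]
  by (simp add: spectral_norm_def matrix_vector_mult_basis)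

text \<open>The head of the non-increasing list dominates all column norms, hence bounds the
  weighted sum for the squared norm of \<open>A *v v\<close>; a unit coordinate vector attains it.
  This turns \<kappa> into a quotient with the spectral norm on top.\<close>

lemma spectral_norm_orthogonal:
  fixes A :: "real^'n^'m"
  assumes orth: "\<forall>i j. i \<noteq> j \<longrightarrow> column i A \<bullet> column j A = 0"
  shows "spectral_norm A = singular_value A 1"
proof -
  let ?s = "singular_values A"
  have len: "length ?s = CARD('n)"
    and set: "set ?s = range (\<lambda>i. norm (column i A))"
    and sorted: "sorted_wrt (\<ge>) ?s"
    using length_singular_values_orthogonal[OF orth] set_singular_values_orthogonal[OF orth]
      sorted_singular_values_orthogonal[OF orth] by auto
  have "?s ! 0 \<in> set ?s"
    by (intro nth_mem) (simp add: len)
  then obtain i where i: "?s ! 0 = norm (column i A)"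
    using set by auto
  have "norm (column j A) \<le> ?s ! 0" for j
  proof -
    obtain k where "k < CARD('n)" "norm (column j A) = ?s ! k"
      using set len by (metis in_set_conv_nth rangeI)
    then show ?thesis
      using sorted len by (cases "k = 0") (auto simp: sorted_wrt_iff_nth_less)
  qed
  then have "(norm (A *v v))\<^sup>2 \<le> (\<Sum>j\<in>UNIV. (?s ! 0)\<^sup>2 * (v $ j)\<^sup>2)" for v
    unfolding norm_mult_vec_orthogonal[OF orth]
    by (intro sum_mono mult_right_mono power_mono) auto
  also have "(\<Sum>j\<in>UNIV. (?s ! 0)\<^sup>2 * (v $ j)\<^sup>2) = (?s ! 0 * norm v)\<^sup>2" for v :: "real^'n"
    by (simp add: power_mult_distrib sum_distrib_left[symmetric] power2_norm_eq_inner inner_vec_def)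
      (simp add: power2_eq_square)
  finally have "norm (A *v v) \<le> ?s ! 0 * norm v" for v
    by (rule power2_le_imp_le) (simp add: i)
  then have "spectral_norm A \<le> ?s ! 0"
    unfolding spectral_norm_def by (intro onorm_le) auto
  moreover have "?s ! 0 \<le> spectral_norm A"
    using i norm_column_le_spectral_norm[of i A] by simp
  ultimately show ?thesis
    by (simp add: singular_value_def)
qed

text \<open>A product has rank at most that of its left factor, so \<open>A\<close> has full column
  rank and is injective; a zero column would put a coordinate vector into the kernel.\<close>

lemma column_nonzero_of_rank:
  fixes A :: "real^'n^'m"
  assumes "rank (A ** transpose A) = CARD('n)"
  shows "column i A \<noteq> 0"
proof
  assume "column i A = 0"
  have "rank A = CARD('n)"
    using assms rank_mul_le_left[of A "transpose A"] rank_bound[of A] by simp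
  then have "inj ((*v) A)"
    by (simp add: full_rank_injective)
  moreover have "A *v axis i 1 = A *v 0"
    using \<open>column i A = 0\<close> by (simp add: matrix_vector_mult_basis)
  ultimately show False
    by (metis axis_eq_0_iff injD zero_neq_one)
qed

section \<open>The recursion for the squared distances\<close>

text \<open>A point of the closure has distance 0 to its nearest point and so equals it. This
  extracts from a well-defined projection the closedness that the \<open>closest_point\<close> facts
  require.\<close>

lemma closed_if_nearest_point_exists:
  fixes S :: "'a::metric_space set"
  assumes "\<And>x. \<exists>p\<in>S. \<forall>y\<in>S. dist x p \<le> dist x y"
  shows "closed S"
proof -
  have "x \<in> S" if "x \<in> closure S" for x
  proof -
    obtain p where p: "p \<in> S" "\<forall>y\<in>S. dist x p \<le> dist x y"
      using assms by blast
    have "dist x p < e" if "0 < e" for e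
      using \<open>x \<in> closure S\<close> that p by (metis closure_approachable dist_commute order_le_less_trans)
    then have "x = p"
      by (metis dist_pos_lt less_irrefl)
    with p show ?thesis by simp
  qed
  then show ?thesis
    by (metis closure_subset closure_eq subsetI subset_antisym)
qed

text \<open>The step size \<open>1 / (\<alpha> * s)\<close> cancels the \<alpha> of the descent
  condition, which leaves the contraction factor 1 - 2/s after expanding the square.\<close>

lemma projected_gradient_step:
  fixes M :: "real^'d^'d" and F :: "real^'r^'d"
  assumes "convex \<F>" "closed \<F>"
    and faithful: "faithful M \<F> \<rho>"
    and descent: "local_descent_cond f M \<F> \<alpha> \<beta> \<epsilon> \<rho>"
    and F: "F \<in> \<F>" "factor_dist M F \<le> \<rho>"
    and G: "norm (gradient f F) \<le> G"
    and "0 < \<alpha>" "0 < s"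
  shows "(factor_dist M (closest_point \<F> (F - (1 / (\<alpha> * s)) *\<^sub>R gradient f F)))\<^sup>2
    \<le> (1 - 2 / s) * (factor_dist M F)\<^sup>2 + 2 * \<epsilon>\<^sup>2 / s + G\<^sup>2 / \<alpha>\<^sup>2 / s\<^sup>2"
proof -
  let ?g = "gradient f F" and ?\<eta> = "1 / (\<alpha> * s)"
  let ?X = "F - ?\<eta> *\<^sub>R ?g"
  obtain P where P: "P \<in> nearest_factors M F"
    and desc: "\<forall>A\<in>equiv_factors M. ?g \<bullet> (F - A)
          \<ge> \<alpha> * (norm (F - P))\<^sup>2 - \<beta>\<^sup>2 / \<alpha> * (norm (P - A))\<^sup>2 - \<alpha> * \<epsilon>\<^sup>2"
    using descent F unfolding local_descent_cond_def factor_ball_def by blast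
  have "P \<in> \<F>"
    using faithful F P unfolding faithful_def factor_ball_def by blast
  have PE: "P \<in> equiv_factors M" and Pmin: "\<And>A. A \<in> equiv_factors M \<Longrightarrow> norm (P - F) \<le> norm (A - F)"
    using P by (auto simp: nearest_factors_def is_arg_min_linorder)
  have dF: "factor_dist M F = norm (F - P)"
    using factor_dist_attained[of M F] PE Pmin by (metis equals0D norm_minus_commute order_antisym)
  have inner: "\<alpha> * (norm (F - P))\<^sup>2 - \<alpha> * \<epsilon>\<^sup>2 \<le> ?g \<bullet> (F - P)"
    using bspec[OF desc PE] by simp
  \<comment> \<open>\<open>P\<close> is nearest to the old point \<open>F\<close>; for the new point
    it is just one competitor, which suffices for an upper bound.\<close>
  have "factor_dist M (closest_point \<F> ?X) \<le> dist (closest_point \<F> ?X) P"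
    unfolding factor_dist_def by (rule infdist_le[OF PE])
  also have "\<dots> \<le> dist ?X P"
    using closest_point_lipschitz[of \<F> ?X P] assms(1,2) \<open>P \<in> \<F>\<close>
    by (auto simp: closest_point_self)
  finally have "(factor_dist M (closest_point \<F> ?X))\<^sup>2 \<le> (dist ?X P)\<^sup>2"
    by (intro power_mono) (simp_all add: factor_dist_def infdist_nonneg)
  also have "(dist ?X P)\<^sup>2 = (norm ((F - P) - ?\<eta> *\<^sub>R ?g))\<^sup>2"
    by (simp add: dist_norm algebra_simps)
  also have "\<dots> = (norm (F - P))\<^sup>2 - 2 * ?\<eta> * (?g \<bullet> (F - P)) + ?\<eta>\<^sup>2 * (norm ?g)\<^sup>2"
    by (simp only: power2_norm_eq_inner inner_diff_left inner_diff_right inner_scaleR_left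
        inner_scaleR_right inner_commute) (simp add: algebra_simps power2_eq_square inner_commute)
  also have "\<dots> \<le> (norm (F - P))\<^sup>2 - 2 * ?\<eta> * (\<alpha> * (norm (F - P))\<^sup>2 - \<alpha> * \<epsilon>\<^sup>2) + ?\<eta>\<^sup>2 * G\<^sup>2"
    using inner G \<open>0 < \<alpha>\<close> \<open>0 < s\<close>
    by (intro add_mono diff_mono mult_left_mono power_mono) auto
  also have "\<dots> = (1 - 2 / s) * (norm (F - P))\<^sup>2 + 2 * \<epsilon>\<^sup>2 / s + G\<^sup>2 / \<alpha>\<^sup>2 / s\<^sup>2"
    using \<open>0 < \<alpha>\<close> \<open>0 < s\<close> by (simp add: field_simps power2_eq_square)
  finally show ?thesis
    by (simp add: dF)
qed

text \<open>The left side is a convex combination of \<open>a\<close> and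
  \<open>e + q / (2 * s)\<close> with weights 1 - 2/s and 2/s.\<close>

lemma recursion_preserves_radius:
  fixes a e q r s :: real
  assumes "2 \<le> s" "a \<le> r" "e + q / (2 * s) \<le> r"
  shows "(1 - 2 / s) * a + 2 * e / s + q / s\<^sup>2 \<le> r"
proof -
  have "(1 - 2 / s) * a + 2 * e / s + q / s\<^sup>2 = (1 - 2 / s) * a + 2 / s * (e + q / (2 * s))"
    using assms(1) by (simp add: field_simps power2_eq_square)
  also have "\<dots> \<le> (1 - 2 / s) * r + 2 / s * r"
    using assms by (intro add_mono mult_left_mono) auto
  finally show ?thesis
    by (simp add: algebra_simps)
qed

text \<open>The \<open>e\<close> terms add up to exactly \<open>e\<close>. The others give at most C
  (s - 1) / s^2, and (s - 1)(s + 1) \<le> s^2.\<close>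

lemma recursion_preserves_rate:
  fixes a C e q s :: real
  assumes "2 \<le> s" "a \<le> C / s + e" "q \<le> C" "0 \<le> C"
  shows "(1 - 2 / s) * a + 2 * e / s + q / s\<^sup>2 \<le> C / (s + 1) + e"
proof -
  have "(1 - 2 / s) * a + 2 * e / s + q / s\<^sup>2
      \<le> (1 - 2 / s) * (C / s + e) + 2 * e / s + C / s\<^sup>2"
    using assms by (intro add_mono mult_left_mono divide_right_mono) auto
  also have "\<dots> = C * (s - 1) / s\<^sup>2 + e"
    using assms by (simp add: field_simps power2_eq_square)
  also have "(s - 1) / s\<^sup>2 \<le> 1 / (s + 1)"
    using assms by (simp add: divide_simps power2_eq_square algebra_simps)
  then have "C * (s - 1) / s\<^sup>2 \<le> C / (s + 1)"
    using mult_left_mono[OF _ \<open>0 \<le> C\<close>] by fastforce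
  finally show ?thesis by simp
qed

section \<open>Convergence of the iterates\<close>

theorem theorem1:
  fixes M :: "real^'d^'d"
    and Fstar :: "real^'r^'d"
    and Ln :: "real^'d^'d \<Rightarrow> real"
    and \<F> :: "(real^'r^'d) set"
    and Fs :: "nat \<Rightarrow> real^'r^'d"
    and \<alpha> \<beta> L \<epsilon> \<tau> :: real
  defines "Lt \<equiv> (\<lambda>F :: real^'r^'d. Ln (F ** transpose F))"
    and "\<sigma> \<equiv> singular_value Fstar"
  defines "\<kappa> \<equiv> \<sigma> 1 / \<sigma> CARD('r)"
    and "\<rho> \<equiv> (1 - \<tau>) * \<sigma> CARD('r)"
  defines "\<eta> \<equiv> (\<lambda>t::nat. 1 / (\<alpha> * (real t + 20 * \<kappa>\<^sup>2 * L\<^sup>2 / \<alpha>\<^sup>2)))"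
  assumes "M \<in> symmetric_matrices" and "positive_semidefinite M" and "rank M = CARD('r)"
    and "Fstar \<in> equiv_factors M"
    and "Ln differentiable_on symmetric_matrices"
    and "convex \<F>"
    and proj_well_defined: "\<forall>X. \<exists>!P. P \<in> \<F> \<and> (\<forall>Y\<in>\<F>. dist X P \<le> dist X Y)"
    and "0 < \<alpha>" and "\<alpha> \<le> L" and "0 \<le> \<epsilon>" and "0 < \<tau>" and "\<tau> < 1/2"
    and "\<epsilon> \<le> (1 - \<tau>) / 2 * \<sigma> CARD('r)"
    and "faithful M \<F> \<rho>"
    and "0 < \<beta>" and "local_descent_cond Lt M \<F> \<alpha> \<beta> \<epsilon> \<rho>"
    and "local_lipschitz_cond Lt M Fstar \<F> L \<rho>"
    and "Fs 0 \<in> \<F> \<inter> factor_ball M \<rho>"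
    and "\<forall>t. Fs (Suc t) = closest_point \<F> (Fs t - \<eta> t *\<^sub>R gradient Lt (Fs t))"
  shows "\<forall>t\<ge>1. (factor_dist M (Fs t))\<^sup>2
           \<le> 20 * L\<^sup>2 * (spectral_norm Fstar)\<^sup>2 / (real t * \<alpha>\<^sup>2) + 4 * \<epsilon>\<^sup>2"
proof -
  let ?a = "\<lambda>t. (factor_dist M (Fs t))\<^sup>2"
  define \<sigma>r where "\<sigma>r = \<sigma> CARD('r)"
  define S where "S = spectral_norm Fstar"
  define c where "c = 20 * \<kappa>\<^sup>2 * L\<^sup>2 / \<alpha>\<^sup>2"
  define Q where "Q = (L * S)\<^sup>2 / \<alpha>\<^sup>2"
  have orth: "\<forall>i j. i \<noteq> j \<longrightarrow> column i Fstar \<bullet> column j Fstar = 0"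
    using \<open>Fstar \<in> equiv_factors M\<close> by (simp add: equiv_factors_def)
  have "Fstar ** transpose Fstar = M"
    using \<open>Fstar \<in> equiv_factors M\<close> by (simp add: equiv_factors_def)
  then have col: "column i Fstar \<noteq> 0" for i
    using \<open>rank M = CARD('r)\<close> by (intro column_nonzero_of_rank) simp
  obtain i where i: "\<sigma>r = norm (column i Fstar)"
    using singular_value_last_orthogonal[OF orth] unfolding \<sigma>r_def \<sigma>_def by blast
  have \<sigma>r: "0 < \<sigma>r" "\<sigma>r \<le> S"
    using i col[of i] norm_column_le_spectral_norm[of i Fstar] by (auto simp: S_def)
  have \<kappa>: "\<kappa> = S / \<sigma>r"
    by (simp add: \<kappa>_def \<sigma>_def S_def \<sigma>r_def spectral_norm_orthogonal[OF orth])
  \<comment> \<open>These bounds give \<open>20 \<le> c\<close>, hence the condition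
    \<open>2 \<le> s\<close> of both recursion lemmas.\<close>
  have "1 \<le> \<kappa>\<^sup>2" "1 \<le> (L / \<alpha>)\<^sup>2"
    using \<sigma>r \<open>0 < \<alpha>\<close> \<open>\<alpha> \<le> L\<close> by (auto simp: \<kappa> intro!: one_le_power)
  then have "1 * 1 \<le> \<kappa>\<^sup>2 * (L / \<alpha>)\<^sup>2"
    by (intro mult_mono) auto
  then have c: "20 \<le> c"
    by (simp add: c_def power_divide)
  have Q: "0 \<le> Q" "20 * Q = c * \<sigma>r\<^sup>2"
    using \<sigma>r by (auto simp: Q_def c_def \<kappa> power_mult_distrib power_divide)
  have \<rho>: "\<rho> = (1 - \<tau>) * \<sigma>r" "\<sigma>r / 2 \<le> \<rho>" "\<rho> \<le> \<sigma>r"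
    using \<open>0 < \<tau>\<close> \<open>\<tau> < 1/2\<close> \<sigma>r by (auto simp: \<rho>_def \<sigma>r_def)
  have \<rho>2: "\<sigma>r\<^sup>2 / 4 \<le> \<rho>\<^sup>2" "\<rho>\<^sup>2 \<le> \<sigma>r\<^sup>2"
    using power_mono[OF \<rho>(2), of 2] power_mono[OF \<rho>(3), of 2] \<rho> \<sigma>r by (auto simp: power_divide)
  have "\<epsilon> \<le> \<rho> / 2"
    using \<open>\<epsilon> \<le> (1 - \<tau>) / 2 * \<sigma> CARD('r)\<close> by (simp add: \<rho>_def)
  then have \<epsilon>: "\<epsilon>\<^sup>2 \<le> \<rho>\<^sup>2 / 4"
    using power_mono[of \<epsilon> "\<rho> / 2" 2] \<open>0 \<le> \<epsilon>\<close> by (simp add: power_divide)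
  have closed: "closed \<F>"
    using proj_well_defined by (intro closed_if_nearest_point_exists) blast
  have "\<F> \<noteq> {}"
    using proj_well_defined by blast
  have step: "?a (Suc t) \<le> (1 - 2 / (t + c)) * ?a t + 2 * \<epsilon>\<^sup>2 / (t + c) + Q / (t + c)\<^sup>2"
    if "Fs t \<in> \<F>" "factor_dist M (Fs t) \<le> \<rho>" for t
  proof -
    have "norm (gradient Lt (Fs t)) \<le> L * S"
      using \<open>local_lipschitz_cond Lt M Fstar \<F> L \<rho>\<close> that
      by (auto simp: local_lipschitz_cond_def factor_ball_def S_def)
    then show ?thesis
      using projected_gradient_step[OF \<open>convex \<F>\<close> closed \<open>faithful M \<F> \<rho>\<close>
          \<open>local_descent_cond Lt M \<F> \<alpha> \<beta> \<epsilon> \<rho>\<close> that _ \<open>0 < \<alpha>\<close>, of "L * S" "t + c"]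
        \<open>\<forall>t. Fs (Suc t) = _ t\<close> c
      by (simp add: \<eta>_def Q_def c_def)
  qed
  \<comment> \<open>The first two conjuncts license \<open>step\<close> at the next index. The rate
    is kept with \<epsilon>^2 rather than 4 \<epsilon>^2, since the recursion reproduces that term
    exactly.\<close>
  have bounds: "Fs t \<in> \<F> \<and> factor_dist M (Fs t) \<le> \<rho> \<and> ?a t \<le> 20 * Q / (t + c) + \<epsilon>\<^sup>2" for t
  proof (induction t)
    case 0
    \<comment> \<open>The offset \<open>c\<close> is such that the rate bound at index 0 is at least
      \<rho>^2.\<close>
    have "20 * Q / c = \<sigma>r\<^sup>2"
      using Q c by simp
    moreover have d: "Fs 0 \<in> \<F>" "factor_dist M (Fs 0) \<le> \<rho>"
      using \<open>Fs 0 \<in> _\<close> by (auto simp: factor_ball_def)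
    moreover have "?a 0 \<le> \<rho>\<^sup>2"
      using d(2) by (intro power_mono) (simp_all add: factor_dist_def infdist_nonneg)
    ultimately show ?case
      using \<rho>2 by (smt (verit) add_0 of_nat_0 zero_le_power2)
  next
    case (Suc t)
    let ?s = "t + c"
    have s: "2 \<le> ?s"
      using c by simp
    have "Q / (2 * ?s) \<le> Q / (2 * c)"
      using Q c by (intro divide_left_mono) auto
    also have "\<dots> = \<sigma>r\<^sup>2 / 40"
      using Q c by (simp add: field_simps)
    \<comment> \<open>Because \<tau> < 1/2, \<sigma>r^2 / 40 is at most \<rho>^2 / 10, while
      \<epsilon>^2 is at most \<rho>^2 / 4.\<close>
    finally have "\<epsilon>\<^sup>2 + Q / (2 * ?s) \<le> \<rho>\<^sup>2"
      using \<epsilon> \<rho>2 by simp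
    moreover have "?a t \<le> \<rho>\<^sup>2"
      using Suc.IH by (intro power_mono) (simp_all add: factor_dist_def infdist_nonneg)
    ultimately have "?a (Suc t) \<le> \<rho>\<^sup>2"
      using order_trans[OF step recursion_preserves_radius[OF s]] Suc.IH by blast
    moreover have "0 \<le> \<rho>"
      using \<rho>(2) \<sigma>r by simp
    ultimately have "factor_dist M (Fs (Suc t)) \<le> \<rho>"
      by (rule power2_le_imp_le)
    moreover have "?a (Suc t) \<le> 20 * Q / (?s + 1) + \<epsilon>\<^sup>2"
      using step[of t] Suc.IH Q(1) recursion_preserves_rate[OF s, of "?a t" "20 * Q" "\<epsilon>\<^sup>2" Q] by simp
    moreover have "Fs (Suc t) \<in> \<F>"
      using \<open>\<forall>t. Fs (Suc t) = _ t\<close> closest_point_in_set[OF closed \<open>\<F> \<noteq> {}\<close>] by simp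
    ultimately show ?case
      by (simp add: add_ac)
  qed
  show ?thesis
  proof (intro allI impI)
    fix t :: nat
    assume "1 \<le> t"
    have "?a t \<le> 20 * Q / (t + c) + \<epsilon>\<^sup>2"
      using bounds by blast
    \<comment> \<open>Dropping the offset \<open>c\<close> from the denominator only weakens the
      bound.\<close>
    also have "\<dots> \<le> 20 * Q / t + 4 * \<epsilon>\<^sup>2"
      using \<open>1 \<le> t\<close> c Q by (intro add_mono divide_left_mono) auto
    finally show "?a t \<le> 20 * L\<^sup>2 * (spectral_norm Fstar)\<^sup>2 / (real t * \<alpha>\<^sup>2) + 4 * \<epsilon>\<^sup>2"
      by (simp add: Q_def S_def power_mult_distrib mult_ac)
  qed
qed

end
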